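(* Let $\Delta$ be a budgeted uncertainty set with deviation $\hat\delta\in\mathbb{R}_+^J$ and budget $\Gamma$. If $$L_{G(p+\hat\delta)}(s,j)-L_{sj}\ \ge\ L^\Delta_{ij}-L_{ij}\qquad\text{for every } i\prec j,$$ then formulation (Dom) is stronger than formulation (Lay), in the sense that $\mathrm{Proj}_h(\mathcal{P}_{Dom})\subseteq\mathrm{Proj}_h(\mathcal{P}_{Lay})$.
   Context: Let $J$ be a finite set of jobs and $\bar J=J\cup\{s,t\}$ with dummy jobs $s,t$. Let $G=(\bar J,\mathcal{A})$ be a directed acyclic graph with source $s$ and sink $t$; there is an arc $(s,i)$ (resp. $(i,t)$) for every $i\in J$ without predecessor (resp. successor) in $J$. For $q\in\mathbb{R}_+^J$ (with the convention $q_s=0$), $G(q)$ denotes $G$ with length $q_i$ on every arc $(i,j)\in\mathcal{A}$. Write $i\prec j$ (for $i,j\in\bar J$) if $i\ne j$ and there is a directed path from $i$ to $j$ in $G$; for $i\prec j$ let $L_{G(q)}(i,j)$ be the length of a longest $i$–$j$ path in $G(q)$. Fix nominal processing times $p\in\mathbb{R}_+^J$ and a deadline $M\ge0$. A budgeted uncertainty set with deviation $\hat\delta\in\mathbb{R}_+^J$ and budget $\Gamma\in\{1,\dots,|J|\}$ is $\Delta=\{(\hat\delta_iu_i)_{i\in J}:\ u\in[0,1]^J,\ \sum_{i\in J}u_i\le\Gamma\}$. For $i\prec j$, $L_{ij}=L_{G(p)}(i,j)$ and $L^\Delta_{ij}=\max_{\delta\in\Delta}L_{G(p+\delta)}(i,j)$.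 For $j\in J$, $D_j=L_{G(p+\hat\delta)}(s,j)-L_{G(p)}(s,j)$. Conventions: $p_s=\hat\delta_s=0$, $h_t=0$. $\mathcal{P}_{Dom}$ (the continuous relaxation of formulation (Dom)) is the set of $(z,h)\in\mathbb{R}^{\bar J}\times[0,1]^J$ such that $z_j-z_i\ge p_i$ for all $(i,j)\in\mathcal{A}$; $z_t\le M$; $z_j-z_i\ge L_{ij}+(L^\Delta_{ij}-L_{ij})h_j$ for all $i,j\in\bar J$ with $i\prec j$; $z_j\ge0$ for all $j\in\bar J$. $\mathcal{P}_{Lay}$ (the continuous relaxation of formulation (Lay)) is the set of $((x^\gamma)_{\gamma\in\{0,\dots,\Gamma\}},h)$ with $x^\gamma\in\mathbb{R}^{\bar J}$, $h\in[0,1]^J$, such that: $x^\gamma_j-x^\gamma_i\ge p_i$ for all $(i,j)\in\mathcal{A}$, $\gamma\in\{0,\dots,\Gamma\}$; $x^\gamma_j-x^{\gamma+1}_i\ge p_i+\hat\delta_i$ for all $(i,j)\in\mathcal{A}$, $\gamma\in\{0,\dots,\Gamma-1\}$; $x^\Gamma_j-x^\gamma_j\ge -D_j(1-h_j)$ for all $j\in J$, $\gamma\in\{0,\dots,\Gamma-1\}$; $x^\Gamma_t\le M$; $x^\gamma_j\ge0$ for all $j\in\bar J$, $\gamma\in\{0,\dots,\Gamma\}$. $\mathrm{Proj}_h$ denotes the projection onto the $h$ variables. *)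

theory Defs
  imports "HOL-Library.FuncSet" "Graph_Theory.Graph_Theory"
begin

text \<open>
  A vector indexed by a finite set \<open>I\<close> is an extensional function, an element of
  \<open>I \<rightarrow>\<^sub>E X\<close>. Vectors over the jobs are extended by zero to the dummy jobs; this realises
  the conventions \<open>p\<^sub>s = 0\<close>, \<open>q\<^sub>s = 0\<close> and \<open>h\<^sub>t = 0\<close>.
\<close>

definition zero_ext :: "'a set \<Rightarrow> ('a \<Rightarrow> real) \<Rightarrow> 'a \<Rightarrow> real" where
  "zero_ext J q i = (if i \<in> J then q i else 0)"

definition vec_add :: "'a set \<Rightarrow> ('a \<Rightarrow> real) \<Rightarrow> ('a \<Rightarrow> real) \<Rightarrow> 'a \<Rightarrow> real" where
  "vec_add J p q = (\<lambda>i\<in>J. p i + q i)"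

definition budgeted_set :: "'a set \<Rightarrow> ('a \<Rightarrow> real) \<Rightarrow> nat \<Rightarrow> ('a \<Rightarrow> real) set" where
  "budgeted_set J dev \<Gamma> =
     {(\<lambda>i\<in>J. dev i * u i) | u. u \<in> J \<rightarrow>\<^sub>E {0..1} \<and> (\<Sum>i\<in>J. u i) \<le> real \<Gamma>}"

text \<open>
  The vertex set is the set of jobs \<open>J\<close> together with the dummies \<open>s\<close> and \<open>t\<close>. As \<open>s\<close> has no
  ingoing and \<open>t\<close> no outgoing arc, having no predecessor (successor) in \<open>J\<close> is the same as
  having no immediate one.
\<close>

locale project_network = pair_fin_digraph G
  for G :: "'a pair_pre_digraph" and J :: "'a set" and s t :: 'a +
  assumes verts_eq: "pverts G = J \<union> {s, t}"
    and s_notin_J: "s \<notin> J" and t_notin_J: "t \<notin> J" and s_neq_t: "s \<noteq> t"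
    and acyclic_arcs: "acyclic (parcs G)"
    and source: "\<And>i. (i, s) \<notin> parcs G"
    and sink: "\<And>i. (t, i) \<notin> parcs G"
    and source_arcs: "\<And>i. i \<in> J \<Longrightarrow> (\<forall>k\<in>J. (k, i) \<notin> parcs G) \<Longrightarrow> (s, i) \<in> parcs G"
    and sink_arcs: "\<And>i. i \<in> J \<Longrightarrow> (\<forall>k\<in>J. (i, k) \<notin> parcs G) \<Longrightarrow> (i, t) \<in> parcs G"
begin

definition precedes :: "'a \<Rightarrow> 'a \<Rightarrow> bool" where
  "precedes i j \<longleftrightarrow> i \<noteq> j \<and> (\<exists>P. apath i P j)"

text \<open>Only meaningful if there is a path from \<open>i\<close> to \<open>j\<close>.\<close>

definition longest :: "('a \<Rightarrow> real) \<Rightarrow> 'a \<Rightarrow> 'a \<Rightarrow> real" where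
  "longest q i j = Max (awalk_cost (\<lambda>e. zero_ext J q (fst e)) ` {P. apath i P j})"

text \<open>
  For a budgeted set \<open>\<Delta>\<close> the supremum is a maximum: \<open>\<Delta>\<close> is nonempty and compact, and
  \<open>longest (vec_add J p \<delta>) i j\<close> is continuous in \<open>\<delta>\<close>.
\<close>

definition longest_wc :: "('a \<Rightarrow> real) \<Rightarrow> ('a \<Rightarrow> real) set \<Rightarrow> 'a \<Rightarrow> 'a \<Rightarrow> real" where
  "longest_wc p \<Delta> i j = (SUP \<delta>\<in>\<Delta>. longest (vec_add J p \<delta>) i j)"

definition max_delay :: "('a \<Rightarrow> real) \<Rightarrow> ('a \<Rightarrow> real) \<Rightarrow> 'a \<Rightarrow> real" where
  "max_delay p dev j = longest (vec_add J p dev) s j - longest p s j"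

definition P_Dom ::
  "('a \<Rightarrow> real) \<Rightarrow> real \<Rightarrow> ('a \<Rightarrow> real) set \<Rightarrow> (('a \<Rightarrow> real) \<times> ('a \<Rightarrow> real)) set" where
  "P_Dom p M \<Delta> =
     {(z, h). z \<in> pverts G \<rightarrow>\<^sub>E UNIV \<and> h \<in> J \<rightarrow>\<^sub>E {0..1} \<and>
       (\<forall>(i, j) \<in> parcs G. z j - z i \<ge> zero_ext J p i) \<and>
       z t \<le> M \<and>
       (\<forall>i\<in>pverts G. \<forall>j\<in>pverts G. precedes i j \<longrightarrow>
          z j - z i \<ge> longest p i j + (longest_wc p \<Delta> i j - longest p i j) * zero_ext J h j) \<and>
       (\<forall>j\<in>pverts G. z j \<ge> 0)}"

definition P_Lay ::
  "('a \<Rightarrow> real) \<Rightarrow> real \<Rightarrow> ('a \<Rightarrow> real) \<Rightarrow> nat \<Rightarrow> ((nat \<Rightarrow> 'a \<Rightarrow> real) \<times> ('a \<Rightarrow> real)) set" where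
  "P_Lay p M dev \<Gamma> =
     {(x, h). x \<in> {0..\<Gamma>} \<rightarrow>\<^sub>E (pverts G \<rightarrow>\<^sub>E UNIV) \<and> h \<in> J \<rightarrow>\<^sub>E {0..1} \<and>
       (\<forall>(i, j) \<in> parcs G. \<forall>\<gamma>\<in>{0..\<Gamma>}. x \<gamma> j - x \<gamma> i \<ge> zero_ext J p i) \<and>
       (\<forall>(i, j) \<in> parcs G. \<forall>\<gamma>\<in>{0..<\<Gamma>}.
          x \<gamma> j - x (\<gamma> + 1) i \<ge> zero_ext J p i + zero_ext J dev i) \<and>
       (\<forall>j\<in>J. \<forall>\<gamma>\<in>{0..<\<Gamma>}. x \<Gamma> j - x \<gamma> j \<ge> - max_delay p dev j * (1 - h j)) \<and>
       x \<Gamma> t \<le> M \<and>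
       (\<forall>j\<in>pverts G. \<forall>\<gamma>\<in>{0..\<Gamma>}. x \<gamma> j \<ge> 0)}"

end

definition Proj_h :: "('b \<times> ('a \<Rightarrow> real)) set \<Rightarrow> ('a \<Rightarrow> real) set" where
  "Proj_h P = snd ` P"

end

theory Submission
  imports Defs
begin

text \<open>
  A point \<open>(z, h)\<close> of the relaxed dominating formulation is lifted to the layered one with the
  same \<open>h\<close>. Read \<open>z\<close> as nominal start times, and let \<open>delayed_start p dev z k j\<close> be the latest
  time at which \<open>j\<close> can start if some vertex \<open>i\<close> starts at \<open>z i\<close> and at most \<open>k\<close> jobs then take
  their full deviation: the maximum of \<open>z i\<close> plus the length of a path from \<open>i\<close> to \<open>j\<close> under such a
  deviation. Layer \<open>\<gamma>\<close> of the lifted point uses \<open>k = \<Gamma> - \<gamma>\<close>.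

  The precedence constraints of the layered formulation hold because an optimal path for the tail
  of an arc can be prolonged by this arc. Inside a layer the deviating set is kept
  (\<open>delayed_start_arc\<close>); between two layers there is budget for one more deviating job, which is
  spent on the tail (\<open>delayed_start_deviating_arc\<close>). In layer \<open>\<Gamma>\<close> nothing deviates, and since
  \<open>z\<close> respects the nominal processing times that layer is \<open>z\<close> itself
  (\<open>delayed_start_no_deviation\<close>); hence the deadline is met.

  The hypothesis on the delays yields the constraint that couples \<open>x\<close> with \<open>h\<close>. Write
  \<open>W\<close> and \<open>L\<close> for the worst-case and the nominal longest path length from \<open>i\<close> to \<open>j\<close>. A full deviation of at most \<open>\<Gamma>\<close> jobs is an element of the budgeted set, so a value of
  \<open>delayed_start\<close> that starts in \<open>i \<noteq> j\<close> is at most \<open>z i + W\<close>. The dominating constraint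
  \<open>z j - z i \<ge> L + (W - L) * h j\<close> turns this bound into \<open>z j + (W - L) * (1 - h j)\<close>, and
  by hypothesis \<open>W - L\<close> is at most the largest delay of \<open>j\<close> (\<open>delayed_start_le_max_delay\<close>).
\<close>

context project_network
begin

abbreviation path_cost :: "('a \<Rightarrow> real) \<Rightarrow> ('a \<times> 'a) awalk \<Rightarrow> real" where
  "path_cost q P \<equiv> awalk_cost (\<lambda>e. zero_ext J q (fst e)) P"

lemma finite_jobs: "finite J"
  using pair_finite_verts verts_eq by (auto dest: finite_subset[rotated])

section \<open>Longest paths\<close>

text \<open>
  A repeated vertex would close a cycle. Hence walks can be prolonged freely although
  \<^const>\<open>longest\<close> only ranges over walks without repeated vertices.
\<close>

lemma awalk_imp_apath:
  assumes "awalk i P j"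
  shows "apath i P j"
proof (rule ccontr)
  assume "\<not> apath i P j"
  with assms have "\<not> distinct (pawalk_verts i P)"
    by (simp add: apath_def)
  from awalk_not_distinct_decomp[OF assms this] obtain R w where "awalk w R w" "0 < length R"
    by blast
  then have "(w, w) \<in> (parcs G)\<^sup>+"
    using reachable1_awalkI[of w R w] by simp
  with acyclic_arcs show False
    by (simp add: acyclic_def)
qed

lemma apath_snoc:
  assumes "apath i P j" and "(j, k) \<in> parcs G"
  shows "apath i (P @ [(j, k)]) k"
proof -
  have "awalk j [(j, k)] k"
    using assms(2) arc_implies_awalk by fastforce
  with assms(1) show ?thesis
    by (intro awalk_imp_apath awalk_appendI) (auto intro: awalkI_apath)
qed

lemma path_cost_mono:
  assumes "\<And>i. i \<in> J \<Longrightarrow> q i \<le> r i"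
  shows "path_cost q P \<le> path_cost r P"
  using assms by (induction P) (auto simp: zero_ext_def add_mono)

lemma path_cost_le_longest: "apath i P j \<Longrightarrow> path_cost q P \<le> longest q i j"
  unfolding longest_def using apaths_finite[of i j] by (intro Max_ge) auto

text \<open>
  This also holds if no path leads from \<open>i\<close> to \<open>j\<close>: both sides are then the maximum of the same
  empty set.
\<close>

lemma longest_mono:
  assumes "\<And>i. i \<in> J \<Longrightarrow> q i \<le> r i"
  shows "longest q i j \<le> longest r i j"
proof (cases "\<exists>P. apath i P j")
  case True
  have "path_cost q P \<le> longest r i j" if "apath i P j" for P
    using path_cost_mono[OF assms] path_cost_le_longest[OF that] by (meson order_trans)
  with True show ?thesis
    unfolding longest_def[of q] using apaths_finite[of i j] by (intro Max.boundedI) auto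
next
  case False
  then show ?thesis
    by (simp add: longest_def)
qed

text \<open>The arc inequalities telescope along a walk.\<close>

lemma path_cost_le_potential_difference:
  assumes "\<And>i j. (i, j) \<in> parcs G \<Longrightarrow> z i + zero_ext J q i \<le> z j"
    and "awalk i P j"
  shows "z i + path_cost q P \<le> z j"
  using assms(2)
proof (induction P arbitrary: i)
  case Nil
  then show ?case by (simp add: awalk_Nil_iff)
next
  case (Cons e P)
  then have "z (snd e) + path_cost q P \<le> z j" "(i, snd e) \<in> parcs G" "fst e = i"
    by (auto simp: awalk_Cons_iff)
  with assms(1)[of i "snd e"] show ?case by simp
qed

section \<open>Full deviation of a set of jobs\<close>

definition deviation_on :: "('a \<Rightarrow> real) \<Rightarrow> 'a set \<Rightarrow> 'a \<Rightarrow> real" where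
  "deviation_on dev S = (\<lambda>i\<in>J. dev i * of_bool (i \<in> S))"

lemma deviation_on_in_budgeted_set:
  assumes "S \<subseteq> J" and "card S \<le> \<Gamma>"
  shows "deviation_on dev S \<in> budgeted_set J dev \<Gamma>"
proof -
  define u :: "'a \<Rightarrow> real" where "u = (\<lambda>i\<in>J. of_bool (i \<in> S))"
  have "sum u J = card (J \<inter> S)"
    using finite_jobs by (simp add: u_def of_bool_def sum.If_cases)
  also have "J \<inter> S = S"
    using assms(1) by blast
  finally have "sum u J \<le> real \<Gamma>"
    using assms(2) by simp
  moreover have "u \<in> J \<rightarrow>\<^sub>E {0..1}"
    by (auto simp: u_def)
  moreover have "deviation_on dev S = (\<lambda>i\<in>J. dev i * u i)"
    by (auto simp: deviation_on_def u_def)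
  ultimately show ?thesis
    unfolding budgeted_set_def by blast
qed

text \<open>
  For \<^const>\<open>longest_wc\<close>, a supremum of reals, to bound its members, the set has to be bounded
  above. The full deviation \<open>dev\<close> dominates every vector of the budgeted set and so gives a bound.
\<close>

lemma path_cost_le_longest_wc:
  assumes dev: "\<And>i. i \<in> J \<Longrightarrow> 0 \<le> dev i"
    and "apath i P j" and "S \<subseteq> J" and "card S \<le> \<Gamma>"
  shows "path_cost (vec_add J p (deviation_on dev S)) P
      \<le> longest_wc p (budgeted_set J dev \<Gamma>) i j"
proof -
  have "longest (vec_add J p \<delta>) i j \<le> longest (vec_add J p dev) i j"
    if "\<delta> \<in> budgeted_set J dev \<Gamma>" for \<delta>
  proof (rule longest_mono)
    fix k assume "k \<in> J"
    from that obtain u where "\<delta> = (\<lambda>i\<in>J. dev i * u i)" "u \<in> J \<rightarrow>\<^sub>E {0..1}"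
      unfolding budgeted_set_def by blast
    with \<open>k \<in> J\<close> mult_left_le[OF _ dev, of "u k" k] show "vec_add J p \<delta> k \<le> vec_add J p dev k"
      by (auto simp: vec_add_def PiE_iff)
  qed
  then have "bdd_above ((\<lambda>\<delta>. longest (vec_add J p \<delta>) i j) ` budgeted_set J dev \<Gamma>)"
    by (rule bdd_aboveI2)
  then have "longest (vec_add J p (deviation_on dev S)) i j
      \<le> longest_wc p (budgeted_set J dev \<Gamma>) i j"
    unfolding longest_wc_def using assms
    by (intro cSUP_upper deviation_on_in_budgeted_set)
  with path_cost_le_longest[OF assms(2)] show ?thesis
    by (meson order_trans)
qed

section \<open>Delayed start times\<close>

text \<open>
  The start vertex \<open>i\<close> of the path is free. It may be \<open>j\<close> itself, with the empty path, so that
  the set is nonempty and no delayed start precedes \<open>z j\<close>.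
\<close>

definition reach_times ::
  "('a \<Rightarrow> real) \<Rightarrow> ('a \<Rightarrow> real) \<Rightarrow> ('a \<Rightarrow> real) \<Rightarrow> nat \<Rightarrow> 'a \<Rightarrow> real set" where
  "reach_times p dev z k j =
     {z i + path_cost (vec_add J p (deviation_on dev S)) P | i P S.
        apath i P j \<and> S \<subseteq> J \<and> card S \<le> k}"

definition delayed_start ::
  "('a \<Rightarrow> real) \<Rightarrow> ('a \<Rightarrow> real) \<Rightarrow> ('a \<Rightarrow> real) \<Rightarrow> nat \<Rightarrow> 'a \<Rightarrow> real" where
  "delayed_start p dev z k j = Max (reach_times p dev z k j)"

lemma finite_reach_times: "finite (reach_times p dev z k j)"
proof -
  have "reach_times p dev z k j
      \<subseteq> (\<lambda>((i, P, j), S). z i + path_cost (vec_add J p (deviation_on dev S)) P)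
          ` ({(i, P, j). apath i P j} \<times> Pow J)"
    by (force simp: reach_times_def)
  then show ?thesis
    using apaths_finite_triple finite_jobs by (auto intro: finite_subset)
qed

lemma start_in_reach_times: "j \<in> pverts G \<Longrightarrow> z j \<in> reach_times p dev z k j"
  unfolding reach_times_def
  by (rule CollectI, rule exI[of _ j], rule exI[of _ "[]"], rule exI[of _ "{}"])
    (simp add: apath_Nil_iff)

lemma start_le_delayed_start: "j \<in> pverts G \<Longrightarrow> z j \<le> delayed_start p dev z k j"
  unfolding delayed_start_def by (intro Max_ge finite_reach_times start_in_reach_times)

lemma delayed_start_attained:
  assumes "j \<in> pverts G"
  obtains i P S where "apath i P j" "S \<subseteq> J" "card S \<le> k"
    "delayed_start p dev z k j = z i + path_cost (vec_add J p (deviation_on dev S)) P"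
proof -
  have "delayed_start p dev z k j \<in> reach_times p dev z k j"
    unfolding delayed_start_def using start_in_reach_times[OF assms]
    by (intro Max_in finite_reach_times) blast
  then show ?thesis
    using that by (auto simp: reach_times_def)
qed

lemma delayed_start_ge:
  assumes "apath i P j" "S \<subseteq> J" "card S \<le> k"
  shows "z i + path_cost (vec_add J p (deviation_on dev S)) P \<le> delayed_start p dev z k j"
  unfolding delayed_start_def
  using assms by (intro Max_ge finite_reach_times) (auto simp: reach_times_def)

lemma delayed_start_arc:
  assumes dev: "\<And>i. i \<in> J \<Longrightarrow> 0 \<le> dev i" and arc: "(j, k) \<in> parcs G"
  shows "delayed_start p dev z n j + zero_ext J p j \<le> delayed_start p dev z n k"
proof -
  obtain i P S where P: "apath i P j" "S \<subseteq> J" "card S \<le> n"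
    "delayed_start p dev z n j = z i + path_cost (vec_add J p (deviation_on dev S)) P"
    using delayed_start_attained[of j] arc_fst_in_verts[OF arc] by (metis fst_conv)
  have "zero_ext J p j \<le> zero_ext J (vec_add J p (deviation_on dev S)) j"
    using dev by (simp add: zero_ext_def vec_add_def deviation_on_def)
  with P(4) delayed_start_ge[OF apath_snoc[OF P(1) arc] P(2,3), of z p dev] show ?thesis
    by simp
qed

text \<open>
  The tail \<open>j\<close> joins the deviating set. Enlarging this set cannot shorten the path that
  precedes \<open>j\<close>, and it adds the deviation of \<open>j\<close> to the last arc.
\<close>

lemma delayed_start_deviating_arc:
  assumes dev: "\<And>i. i \<in> J \<Longrightarrow> 0 \<le> dev i" and arc: "(j, k) \<in> parcs G"
  shows "delayed_start p dev z n j + zero_ext J p j + zero_ext J dev j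
      \<le> delayed_start p dev z (Suc n) k"
proof -
  obtain i P S where P: "apath i P j" "S \<subseteq> J" "card S \<le> n"
    "delayed_start p dev z n j = z i + path_cost (vec_add J p (deviation_on dev S)) P"
    using delayed_start_attained[of j] arc_fst_in_verts[OF arc] by (metis fst_conv)
  \<comment> \<open>The intersection matters for \<open>j = s\<close>, which is no job and has deviation zero.\<close>
  define S' where "S' = insert j S \<inter> J"
  have "card S' \<le> card (insert j S)"
    unfolding S'_def using P(2) finite_jobs by (intro card_mono) (auto intro: finite_subset)
  also have "\<dots> \<le> Suc n"
    using P(3) card_insert_le_m1[of "Suc n" S j] by simp
  finally have S': "S' \<subseteq> J" "card S' \<le> Suc n"
    by (auto simp: S'_def)
  have "path_cost (vec_add J p (deviation_on dev S)) P
      \<le> path_cost (vec_add J p (deviation_on dev S')) P"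
    using dev by (intro path_cost_mono) (auto simp: vec_add_def deviation_on_def S'_def)
  moreover have "zero_ext J (vec_add J p (deviation_on dev S')) j = zero_ext J p j + zero_ext J dev j"
    by (simp add: zero_ext_def vec_add_def deviation_on_def S'_def)
  ultimately show ?thesis
    using P(4) delayed_start_ge[OF apath_snoc[OF P(1) arc] S', of z p dev] by simp
qed

text \<open>
  Start times that respect the nominal processing times differ by at least the nominal length
  of any path between their vertices, so without deviations no path leads to a later start.
\<close>

lemma delayed_start_no_deviation:
  assumes "\<And>i j. (i, j) \<in> parcs G \<Longrightarrow> z i + zero_ext J p i \<le> z j" and "j \<in> pverts G"
  shows "delayed_start p dev z 0 j = z j"
proof -
  obtain i P S where P: "apath i P j" "S \<subseteq> J" "card S \<le> 0"
    "delayed_start p dev z 0 j = z i + path_cost (vec_add J p (deviation_on dev S)) P"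
    using delayed_start_attained[OF assms(2)] by blast
  from P(2,3) have "S = {}"
    using finite_jobs by (auto dest: finite_subset)
  then have "path_cost (vec_add J p (deviation_on dev S)) P \<le> path_cost p P"
    by (intro path_cost_mono) (simp add: vec_add_def deviation_on_def)
  also have "z i + path_cost p P \<le> z j"
    using assms(1) awalkI_apath[OF P(1)] by (rule path_cost_le_potential_difference)
  finally show ?thesis
    using P(4) start_le_delayed_start[OF assms(2), of z p dev 0] by simp
qed

lemma max_delay_nonneg:
  assumes "\<And>i. i \<in> J \<Longrightarrow> 0 \<le> dev i"
  shows "0 \<le> max_delay p dev j"
  unfolding max_delay_def
  using longest_mono[of p "vec_add J p dev" s j] assms by (simp add: vec_add_def)

text \<open>
  The number \<open>c\<close> stands for \<open>h j\<close>. Since \<open>1 - c\<close> is nonnegative, the bound on the worst-case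
  increase of the path length can be scaled by it. The empty path, for which \<open>j\<close> does not
  precede itself, is covered by the nonnegativity of the delay.
\<close>

lemma delayed_start_le_max_delay:
  assumes dev: "\<And>i. i \<in> J \<Longrightarrow> 0 \<le> dev i"
    and dom: "\<And>i. i \<in> pverts G \<Longrightarrow> precedes i j \<Longrightarrow>
      longest_wc p (budgeted_set J dev \<Gamma>) i j - longest p i j \<le> max_delay p dev j"
    and sep: "\<And>i. i \<in> pverts G \<Longrightarrow> precedes i j \<Longrightarrow>
      longest p i j + (longest_wc p (budgeted_set J dev \<Gamma>) i j - longest p i j) * c \<le> z j - z i"
    and j: "j \<in> pverts G" and c: "c \<le> 1" and k: "k \<le> \<Gamma>"
  shows "delayed_start p dev z k j \<le> z j + max_delay p dev j * (1 - c)"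
proof -
  obtain i P S where P: "apath i P j" "S \<subseteq> J" "card S \<le> k"
    "delayed_start p dev z k j = z i + path_cost (vec_add J p (deviation_on dev S)) P"
    using delayed_start_attained[OF j] by blast
  show ?thesis
  proof (cases "i = j")
    case True
    with P(1) have "P = []"
      using apath_nonempty_ends by blast
    with True P(4) c max_delay_nonneg[OF dev] show ?thesis
      by simp
  next
    case False
    let ?W = "longest_wc p (budgeted_set J dev \<Gamma>) i j" and ?L = "longest p i j"
    have i: "i \<in> pverts G" "precedes i j"
      using P(1) False by (auto simp: precedes_def dest: awalkI_apath)
    have "path_cost (vec_add J p (deviation_on dev S)) P \<le> ?W"
      using dev P(1,2,3) k by (intro path_cost_le_longest_wc) auto
    moreover have "(?W - ?L) * (1 - c) \<le> max_delay p dev j * (1 - c)"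
      using dom[OF i] c by (intro mult_right_mono) auto
    ultimately show ?thesis
      using P(4) sep[OF i] by (simp add: algebra_simps)
  qed
qed

lemma P_Dom_lifts_to_P_Lay:
  fixes p dev z h :: "'a \<Rightarrow> real" and M :: real and \<Gamma> :: nat
  assumes dev: "\<And>i. i \<in> J \<Longrightarrow> 0 \<le> dev i"
    and dom: "\<And>i j. i \<in> pverts G \<Longrightarrow> j \<in> pverts G \<Longrightarrow> precedes i j \<Longrightarrow>
      longest_wc p (budgeted_set J dev \<Gamma>) i j - longest p i j \<le> max_delay p dev j"
    and zh: "(z, h) \<in> P_Dom p M (budgeted_set J dev \<Gamma>)"
  shows "((\<lambda>\<gamma>\<in>{0..\<Gamma>}. \<lambda>j\<in>pverts G. delayed_start p dev z (\<Gamma> - \<gamma>) j), h) \<in> P_Lay p M dev \<Gamma>"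
proof -
  have h: "h \<in> J \<rightarrow>\<^sub>E {0..1}" and M: "z t \<le> M"
    and z: "\<And>j. j \<in> pverts G \<Longrightarrow> 0 \<le> z j"
    and arcs: "\<And>i j. (i, j) \<in> parcs G \<Longrightarrow> z i + zero_ext J p i \<le> z j"
    and sep: "\<And>i j. i \<in> pverts G \<Longrightarrow> j \<in> pverts G \<Longrightarrow> precedes i j \<Longrightarrow>
      longest p i j + (longest_wc p (budgeted_set J dev \<Gamma>) i j - longest p i j) * zero_ext J h j
        \<le> z j - z i"
    using zh by (fastforce simp: P_Dom_def)+
  have ends: "i \<in> pverts G" "j \<in> pverts G" if "(i, j) \<in> parcs G" for i j
    using that arc_fst_in_verts arc_snd_in_verts by fastforce+
  have bottom: "delayed_start p dev z 0 j = z j" if "j \<in> pverts G" for j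
    using arcs that by (rule delayed_start_no_deviation)
  have delay: "- (max_delay p dev j * (1 - h j)) \<le> z j - delayed_start p dev z k j"
    if "j \<in> J" "k \<le> \<Gamma>" for j k
  proof -
    have j: "j \<in> pverts G" and hj: "zero_ext J h j = h j" "h j \<le> 1"
      using that h verts_eq by (auto simp: zero_ext_def PiE_iff)
    have "delayed_start p dev z k j \<le> z j + max_delay p dev j * (1 - h j)"
      using dev dom[OF _ j] sep[OF _ j, unfolded hj] j hj(2) that(2)
      by (rule delayed_start_le_max_delay)
    then show ?thesis
      by simp
  qed
  have nonneg: "0 \<le> delayed_start p dev z k j" if "j \<in> pverts G" for k j
    using z[OF that] start_le_delayed_start[OF that] by (rule order_trans)
  have shift: "zero_ext J p i + zero_ext J dev i
      \<le> delayed_start p dev z (\<Gamma> - \<gamma>) j - delayed_start p dev z (\<Gamma> - Suc \<gamma>) i"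
    if "(i, j) \<in> parcs G" "\<gamma> < \<Gamma>" for i j \<gamma>
    using delayed_start_deviating_arc[of dev i j p z "\<Gamma> - Suc \<gamma>"] dev that
    by (simp add: Suc_diff_Suc)
  have same: "zero_ext J p i \<le> delayed_start p dev z k j - delayed_start p dev z k i"
    if "(i, j) \<in> parcs G" for i j k
    using delayed_start_arc[of dev i j p z k] dev that by simp
  have "t \<in> pverts G" and J: "\<And>j. j \<in> J \<Longrightarrow> j \<in> pverts G"
    using verts_eq by auto
  then show ?thesis
    unfolding P_Lay_def using h M nonneg
    by (auto simp: bottom ends shift same delay J)
qed

end

theorem proposition4:
  fixes G :: "'a pair_pre_digraph" and J :: "'a set" and s t :: 'a
    and p dev :: "'a \<Rightarrow> real" and M :: real and \<Gamma> :: nat and \<Delta> :: "('a \<Rightarrow> real) set"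
  assumes "project_network G J s t"
    and "p \<in> J \<rightarrow>\<^sub>E {0..}"
    and "0 \<le> M"
    and "dev \<in> J \<rightarrow>\<^sub>E {0..}"
    and "\<Gamma> \<in> {1..card J}"
    and "\<Delta> = budgeted_set J dev \<Gamma>"
    and "\<forall>i\<in>pverts G. \<forall>j\<in>pverts G. project_network.precedes G i j \<longrightarrow>
           project_network.longest G J (vec_add J p dev) s j - project_network.longest G J p s j
           \<ge> project_network.longest_wc G J p \<Delta> i j - project_network.longest G J p i j"
  shows "Proj_h (project_network.P_Dom G J t p M \<Delta>)
           \<subseteq> Proj_h (project_network.P_Lay G J s t p M dev \<Gamma>)"
proof -
  interpret project_network G J s t
    by (fact assms(1))
  have dev: "\<And>i. i \<in> J \<Longrightarrow> 0 \<le> dev i"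
    using assms(4) by (auto simp: PiE_iff)
  have dom: "\<And>i j. i \<in> pverts G \<Longrightarrow> j \<in> pverts G \<Longrightarrow> precedes i j \<Longrightarrow>
      longest_wc p (budgeted_set J dev \<Gamma>) i j - longest p i j \<le> max_delay p dev j"
    using assms(6,7) by (simp add: max_delay_def)
  show ?thesis
    unfolding Proj_h_def assms(6)
    using P_Dom_lifts_to_P_Lay[OF dev dom] by force
qed

end
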